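(* Let $a_j>0$, $\alpha_j>-1$ for $j=1,2$, let $f_j(x)=\frac{a_j^{\alpha_j+1}}{\Gamma(\alpha_j+1)}x^{\alpha_j}e^{-a_jx}$ for $x>0$, let $c=\prod_{j=1}^2\frac{a_j^{\alpha_j+1}}{\Gamma(\alpha_j+1)}$, and let $g_2(u)=\int_0^\infty v f_1(v)f_2(uv)\,dv$ for $u>0$. Then for all $u>0$ $$g_2(u)=c\,\Gamma(\alpha_1+\alpha_2+2)\,u^{\alpha_2}(a_1+a_2u)^{-(\alpha_1+\alpha_2+2)},$$ and $$g_2(u)=\frac{\Gamma(\alpha_1+\alpha_2+2)}{\Gamma(\alpha_1+1)\Gamma(\alpha_2+1)}\,\frac{1}{u}\begin{cases}\left(\frac{a_2u}{a_1}\right)^{\alpha_2+1}{}_1F_0\left(2+\alpha_1+\alpha_2;\ ;-\frac{a_2u}{a_1}\right), & 0<\frac{a_2u}{a_1}<1,\\[4pt] \left(\frac{a_1}{a_2u}\right)^{\alpha_1+1}{}_1F_0\left(2+\alpha_1+\alpha_2;\ ;-\frac{a_1}{a_2u}\right), & 1\le\frac{a_2u}{a_1}<\infty.\end{cases}$$ Moreover $g_2$ is a probability density on $(0,\infty)$.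
   Context: The function $g_2$ is the Mellin convolution of a ratio of $f_1$ and $f_2$ (the density of $x_2/x_1$ for independent positive random variables $x_1,x_2$ with densities $f_1,f_2$). ${}_1F_0(b;\ ;z)=\sum_{k\ge0}\frac{(b)_k}{k!}z^k$ for $|z|<1$, where $(b)_k=b(b+1)\cdots(b+k-1)$, extended by analytic continuation to $\mathbb{C}\setminus[1,\infty)$ (used at $z=-1$). *)

theory Defs
  imports "HOL-Complex_Analysis.Complex_Analysis"
begin

definition cut_plane :: "complex set" where
  "cut_plane = - (complex_of_real ` {1..})"

definition is_hyp1F0 :: "complex \<Rightarrow> (complex \<Rightarrow> complex) \<Rightarrow> bool" where
  "is_hyp1F0 b F \<longleftrightarrow> F holomorphic_on cut_plane \<and>
     (\<forall>z. norm z < 1 \<longrightarrow> (\<lambda>k. pochhammer b k / fact k * z ^ k) sums F z)"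

text \<open>The analytic continuation exists and is unique on the cut plane (see below);
  off the cut plane the value is unspecified.\<close>

definition hyp1F0 :: "complex \<Rightarrow> complex \<Rightarrow> complex" where
  "hyp1F0 b z = (THE w. \<exists>F. is_hyp1F0 b F \<and> F z = w)"

lemma cut_plane_iff: "z \<in> cut_plane \<longleftrightarrow> 1 - z \<notin> \<real>\<^sub>\<le>\<^sub>0"
proof -
  have "z \<in> complex_of_real ` {1..} \<longleftrightarrow> Im z = 0 \<and> Re z \<ge> 1"
    by (auto simp: image_iff complex_eq_iff intro!: bexI[of _ "Re z"])
  then show ?thesis
    by (auto simp: cut_plane_def complex_nonpos_Reals_iff)
qed

lemma is_hyp1F0_powr: "is_hyp1F0 b (\<lambda>z. (1 - z) powr (- b))"
  unfolding is_hyp1F0_def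
proof (intro conjI allI impI)
  show "(\<lambda>z. (1 - z) powr (- b)) holomorphic_on cut_plane"
    by (intro holomorphic_intros) (simp add: cut_plane_iff)
next
  fix z :: complex assume z: "norm z < 1"
  have "(\<lambda>k. ((- b) gchoose k) * (- z) ^ k) sums (1 + (- z)) powr (- b)"
    using z by (intro gen_binomial_complex) simp
  moreover have "((- b) gchoose k) * (- z) ^ k = pochhammer b k / fact k * z ^ k" for k
  proof -
    have "(- 1) ^ k * ((- 1) ^ k :: complex) = 1"
      by (simp flip: power_mult_distrib)
    then show ?thesis
      by (simp add: gbinomial_pochhammer power_minus[of z] mult_ac)
  qed
  ultimately show "(\<lambda>k. pochhammer b k / fact k * z ^ k) sums (1 - z) powr (- b)"
    by simp
qed

lemma is_hyp1F0_unique: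
  assumes F: "is_hyp1F0 b F" and G: "is_hyp1F0 b G" and z: "z \<in> cut_plane"
  shows "F z = G z"
proof -
  have star: "starlike cut_plane"
    unfolding starlike_def
  proof (intro bexI[of _ 0] ballI subsetI)
    fix x y assume x: "x \<in> cut_plane" and "y \<in> closed_segment 0 x"
    then obtain u where u: "0 \<le> u" "u \<le> 1" "y = of_real u * x"
      by (auto simp: in_segment scaleR_conv_of_real)
    show "y \<in> cut_plane"
    proof (cases "Im y = 0 \<and> Re y \<ge> 1")
      case True
      then have uy: "u * Im x = 0" "u * Re x \<ge> 1"
        by (simp_all add: u)
      then have "u > 0" using u by (cases "u = 0") auto
      then have "Im x = 0" "Re x > 0"
        using uy by (auto simp: zero_less_mult_iff dest: less_le_trans[OF zero_less_one])
      moreover from this u have "u * Re x \<le> 1 * Re x"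
        by (intro mult_right_mono) auto
      ultimately show ?thesis
        using x uy by (simp add: cut_plane_iff complex_nonpos_Reals_iff)
    next
      case False
      then show ?thesis by (auto simp: cut_plane_iff complex_nonpos_Reals_iff)
    qed
  qed (simp add: cut_plane_iff)
  have "closed (complex_of_real ` {1..})"
    by (intro closed_injective_linear_image)
       (auto simp: inj_on_def intro: bounded_linear.linear[OF bounded_linear_of_real])
  then have "open cut_plane" by (simp add: cut_plane_def open_Compl)
  moreover have "ball 0 1 \<subseteq> cut_plane"
    by (auto simp: cut_plane_def)
  moreover have "F w = G w" if "w \<in> ball 0 1" for w
    using F G that by (auto simp: is_hyp1F0_def intro: sums_unique2)
  moreover have "F holomorphic_on cut_plane" "G holomorphic_on cut_plane"
    using F G by (simp_all add: is_hyp1F0_def)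
  ultimately show ?thesis
    using analytic_continuation_open[of "ball 0 1" cut_plane F G z]
      starlike_imp_connected[OF star] z by simp
qed

lemma hyp1F0_eq:
  assumes "is_hyp1F0 b F" "z \<in> cut_plane"
  shows "hyp1F0 b z = F z"
  unfolding hyp1F0_def
proof (rule the_equality)
  show "\<exists>G. is_hyp1F0 b G \<and> G z = F z"
    using assms(1) by blast
  show "w = F z" if "\<exists>G. is_hyp1F0 b G \<and> G z = w" for w
    using that is_hyp1F0_unique[OF _ assms] by blast
qed

lemma hyp1F0_is_hyp1F0: "is_hyp1F0 b (hyp1F0 b)"
proof -
  have "z \<in> cut_plane" if "norm z < 1" for z using that by (auto simp: cut_plane_def)
  moreover have "hyp1F0 b z = (1 - z) powr (- b)" if "z \<in> cut_plane" for z
    using that by (rule hyp1F0_eq[OF is_hyp1F0_powr])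
  moreover from this have "hyp1F0 b holomorphic_on cut_plane"
    using is_hyp1F0_powr[of b] holomorphic_transform[of "\<lambda>z. (1 - z) powr (- b)" cut_plane "hyp1F0 b"]
    unfolding is_hyp1F0_def by metis
  ultimately show ?thesis
    using is_hyp1F0_powr[of b] unfolding is_hyp1F0_def by simp
qed

definition prob_density_on :: "real set \<Rightarrow> (real \<Rightarrow> real) \<Rightarrow> bool" where
  "prob_density_on S g \<longleftrightarrow>
     (\<forall>x\<in>S. 0 \<le> g x) \<and> set_integrable lborel S g \<and> (LINT x:S|lborel. g x) = 1"

end

theory Submission
  imports Defs
begin

text \<open>
  Both densities are Gamma densities. In the Mellin convolution the two exponentials merge into
  \<open>exp (- (a 1 + a 2 * u) * v)\<close> and the powers of \<open>v\<close> into \<open>v powr (\<alpha> 1 + \<alpha> 2 + 1)\<close>, so that the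
  integral over \<open>v\<close> is a rescaled Euler integral (\<open>nn_integral_powr_exp\<close>); this yields the closed
  form (\<open>nn_integral_ratio_gamma_density\<close>).

  By the binomial series, the function \<^const>\<open>hyp1F0\<close> with parameter \<open>b\<close> is
  \<open>z \<mapsto> (1 - z) powr (- b)\<close> on the whole cut plane (\<open>hyp1F0_minus_of_real\<close>). The two cases of the
  hypergeometric formula thus arise from the closed form by factoring either \<open>a 1\<close> or \<open>a 2 * u\<close>
  out of \<open>a 1 + a 2 * u\<close>, whichever is larger; this keeps the argument in the closed unit disc, with
  the boundary point \<open>-1\<close> reached when the two agree.

  That the total mass is 1 holds for the ratio of any two independent positive variables: by Tonelli
  one may integrate over \<open>u\<close> first, and the factor \<open>v\<close> is exactly the Jacobian of \<open>u \<mapsto> u * v\<close>, so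
  the double integral splits into the product of the two masses
  (\<open>nn_integral_ratio_convolution\<close>).
\<close>

section \<open>Gamma densities\<close>

text \<open>The substitution \<open>t = b * x\<close> in Euler's integral for the Gamma function.\<close>

lemma nn_integral_powr_exp:
  fixes b s :: real
  assumes b: "b > 0" and s: "s > -1"
  shows "(\<integral>\<^sup>+x. ennreal (indicator {0<..} x * (x powr s * exp (- b * x))) \<partial>lborel)
           = ennreal (Gamma (s + 1) / b powr (s + 1))" (is "?I = _")
proof -
  let ?h = "\<lambda>t. ennreal (indicator {0..} t * t powr s / exp t)"
  have "ennreal (Gamma (s + 1)) = (\<integral>\<^sup>+t. ?h t \<partial>lborel)"
    using Gamma_conv_nn_integral_real[of "s + 1"] s by simp
  also have "\<dots> = ennreal b * (\<integral>\<^sup>+x. ?h (b * x) \<partial>lborel)"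
    using nn_integral_real_affine[of ?h b 0] b by simp
  \<comment> \<open>The endpoint 0 may be dropped from the range since \<open>0 powr s = 0\<close>.\<close>
  also have "(\<integral>\<^sup>+x. ?h (b * x) \<partial>lborel)
      = (\<integral>\<^sup>+x. ennreal (b powr s) *
            ennreal (indicator {0<..} x * (x powr s * exp (- b * x))) \<partial>lborel)"
    using b
    by (intro nn_integral_cong)
       (auto simp: indicator_def powr_mult exp_minus field_simps zero_le_mult_iff
             simp flip: ennreal_mult')
  also have "\<dots> = ennreal (b powr s) * ?I"
    by (intro nn_integral_cmult) simp
  finally have "ennreal (Gamma (s + 1)) = ennreal (b powr (s + 1)) * ?I"
    using b by (simp add: powr_add ennreal_mult' mult.assoc mult.left_commute)
  moreover have "ennreal (inverse (b powr (s + 1))) * ennreal (b powr (s + 1)) = 1"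
    using b by (simp flip: ennreal_mult')
  ultimately have "?I = ennreal (inverse (b powr (s + 1))) * ennreal (Gamma (s + 1))"
    by (simp flip: mult.assoc)
  also have "\<dots> = ennreal (Gamma (s + 1) / b powr (s + 1))"
    by (subst ennreal_mult' [symmetric]) (auto simp: field_simps)
  finally show ?thesis .
qed

text \<open>
  The indicator extends the density by 0 to the whole line, so that substitutions and Tonelli apply
  to integrals over all reals.
\<close>

definition gamma_density :: "real \<Rightarrow> real \<Rightarrow> real \<Rightarrow> real" where
  "gamma_density a \<alpha> x =
     indicator {0<..} x * (a powr (\<alpha> + 1) / Gamma (\<alpha> + 1) * x powr \<alpha> * exp (- a * x))"

lemma borel_measurable_gamma_density [measurable]:
  "gamma_density a \<alpha> \<in> borel_measurable borel"
  unfolding gamma_density_def [abs_def] by measurable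

lemma gamma_density_nonneg: "\<alpha> > -1 \<Longrightarrow> gamma_density a \<alpha> x \<ge> 0"
  unfolding gamma_density_def using Gamma_real_pos[of "\<alpha> + 1"] by auto

lemma gamma_density_eq_0: "x \<le> 0 \<Longrightarrow> gamma_density a \<alpha> x = 0"
  by (simp add: gamma_density_def)

lemma nn_integral_gamma_density:
  assumes "a > 0" "\<alpha> > -1"
  shows "(\<integral>\<^sup>+x. ennreal (gamma_density a \<alpha> x) \<partial>lborel) = 1"
proof -
  have G: "Gamma (\<alpha> + 1) > 0" using assms by (intro Gamma_real_pos) simp
  have "(\<integral>\<^sup>+x. ennreal (gamma_density a \<alpha> x) \<partial>lborel) =
     (\<integral>\<^sup>+x. ennreal (a powr (\<alpha> + 1) / Gamma (\<alpha> + 1)) *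
            ennreal (indicator {0<..} x * (x powr \<alpha> * exp (- a * x))) \<partial>lborel)"
    using G by (intro nn_integral_cong) (simp add: gamma_density_def mult_ac flip: ennreal_mult')
  also have "\<dots> = ennreal (a powr (\<alpha> + 1) / Gamma (\<alpha> + 1)) *
                   ennreal (Gamma (\<alpha> + 1) / a powr (\<alpha> + 1))"
    by (subst nn_integral_cmult) (use nn_integral_powr_exp[OF assms] in auto)
  also have "\<dots> = 1"
    using less_imp_neq[OF G] assms by (simp flip: ennreal_mult')
  finally show ?thesis .
qed

section \<open>Mellin convolution of a ratio\<close>

text \<open>
  Integrating over \<open>u\<close> first, the factor \<open>v\<close> is absorbed by the substitution \<open>w = u * v\<close>. As \<open>f\<close>
  lives on the positive reals, \<open>v\<close> is there the absolute value of the Jacobian.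
\<close>

lemma nn_integral_ratio_convolution:
  fixes f g :: "real \<Rightarrow> ennreal"
  assumes [measurable]: "f \<in> borel_measurable borel" "g \<in> borel_measurable borel"
    and f0: "\<And>v. v \<le> 0 \<Longrightarrow> f v = 0"
  shows "(\<integral>\<^sup>+u. \<integral>\<^sup>+v. ennreal v * f v * g (u * v) \<partial>lborel \<partial>lborel)
           = (\<integral>\<^sup>+v. f v \<partial>lborel) * (\<integral>\<^sup>+w. g w \<partial>lborel)"
proof -
  have inner: "(\<integral>\<^sup>+u. ennreal v * f v * g (u * v) \<partial>lborel) = f v * (\<integral>\<^sup>+w. g w \<partial>lborel)" for v
  proof (cases "v > 0")
    case True
    have "(\<integral>\<^sup>+u. ennreal v * f v * g (u * v) \<partial>lborel)
        = f v * (ennreal v * (\<integral>\<^sup>+u. g (u * v) \<partial>lborel))"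
      by (subst nn_integral_cmult) (auto simp: mult_ac)
    also have "ennreal v * (\<integral>\<^sup>+u. g (u * v) \<partial>lborel) = (\<integral>\<^sup>+w. g w \<partial>lborel)"
      using nn_integral_real_affine[of g v 0] True by (simp add: mult.commute)
    finally show ?thesis .
  qed (simp add: f0)
  have "(\<integral>\<^sup>+u. \<integral>\<^sup>+v. ennreal v * f v * g (u * v) \<partial>lborel \<partial>lborel)
      = (\<integral>\<^sup>+v. \<integral>\<^sup>+u. ennreal v * f v * g (u * v) \<partial>lborel \<partial>lborel)"
    by (rule lborel_pair.Fubini') measurable
  then show ?thesis
    by (simp add: inner nn_integral_multc)
qed

text \<open>The density of a beta prime distribution with rescaled argument.\<close>

definition gamma_ratio_density :: "real \<Rightarrow> real \<Rightarrow> real \<Rightarrow> real \<Rightarrow> real \<Rightarrow> real" where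
  "gamma_ratio_density a\<^sub>1 \<alpha>\<^sub>1 a\<^sub>2 \<alpha>\<^sub>2 u =
     a\<^sub>1 powr (\<alpha>\<^sub>1 + 1) / Gamma (\<alpha>\<^sub>1 + 1) * (a\<^sub>2 powr (\<alpha>\<^sub>2 + 1) / Gamma (\<alpha>\<^sub>2 + 1)) *
     Gamma (\<alpha>\<^sub>1 + \<alpha>\<^sub>2 + 2) * u powr \<alpha>\<^sub>2 * (a\<^sub>1 + a\<^sub>2 * u) powr (- (\<alpha>\<^sub>1 + \<alpha>\<^sub>2 + 2))"

lemma borel_measurable_gamma_ratio_density [measurable]:
  "gamma_ratio_density a\<^sub>1 \<alpha>\<^sub>1 a\<^sub>2 \<alpha>\<^sub>2 \<in> borel_measurable borel"
  unfolding gamma_ratio_density_def [abs_def] by measurable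

lemma gamma_ratio_density_nonneg:
  assumes "\<alpha>\<^sub>1 > -1" "\<alpha>\<^sub>2 > -1"
  shows "gamma_ratio_density a\<^sub>1 \<alpha>\<^sub>1 a\<^sub>2 \<alpha>\<^sub>2 u \<ge> 0"
proof -
  have "Gamma (\<alpha>\<^sub>1 + 1) > 0" "Gamma (\<alpha>\<^sub>2 + 1) > 0" "Gamma (\<alpha>\<^sub>1 + \<alpha>\<^sub>2 + 2) > 0"
    using assms by (auto intro!: Gamma_real_pos)
  then show ?thesis by (simp add: gamma_ratio_density_def)
qed

lemma nn_integral_ratio_gamma_density:
  assumes a: "a\<^sub>1 > 0" "a\<^sub>2 > 0" and \<alpha>: "\<alpha>\<^sub>1 > -1" "\<alpha>\<^sub>2 > -1" and u: "u > 0"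
  shows "(\<integral>\<^sup>+v. ennreal (v * gamma_density a\<^sub>1 \<alpha>\<^sub>1 v * gamma_density a\<^sub>2 \<alpha>\<^sub>2 (u * v)) \<partial>lborel)
           = ennreal (gamma_ratio_density a\<^sub>1 \<alpha>\<^sub>1 a\<^sub>2 \<alpha>\<^sub>2 u)"
proof -
  define C where
    "C = a\<^sub>1 powr (\<alpha>\<^sub>1 + 1) / Gamma (\<alpha>\<^sub>1 + 1) * (a\<^sub>2 powr (\<alpha>\<^sub>2 + 1) / Gamma (\<alpha>\<^sub>2 + 1)) * u powr \<alpha>\<^sub>2"
  have "Gamma (\<alpha>\<^sub>1 + 1) > 0" "Gamma (\<alpha>\<^sub>2 + 1) > 0"
    using \<alpha> by (auto intro!: Gamma_real_pos)
  then have C: "C \<ge> 0" by (simp add: C_def)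
  have b: "a\<^sub>1 + a\<^sub>2 * u > 0" using a u by (simp add: add_pos_pos)
  have integrand: "v * gamma_density a\<^sub>1 \<alpha>\<^sub>1 v * gamma_density a\<^sub>2 \<alpha>\<^sub>2 (u * v)
      = C * (indicator {0<..} v * (v powr (\<alpha>\<^sub>1 + \<alpha>\<^sub>2 + 1) * exp (- (a\<^sub>1 + a\<^sub>2 * u) * v)))" for v
  proof (cases "v > 0")
    case True
    then have "v powr (\<alpha>\<^sub>1 + \<alpha>\<^sub>2 + 1) = v * v powr \<alpha>\<^sub>1 * v powr \<alpha>\<^sub>2"
      by (simp add: powr_add)
    moreover have "exp (- (a\<^sub>1 + a\<^sub>2 * u) * v) = exp (- a\<^sub>1 * v) * exp (- a\<^sub>2 * (u * v))"
      by (simp add: algebra_simps flip: exp_add)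
    moreover have "(u * v) powr \<alpha>\<^sub>2 = u powr \<alpha>\<^sub>2 * v powr \<alpha>\<^sub>2"
      using True u by (simp add: powr_mult)
    ultimately show ?thesis
      using True u by (simp add: gamma_density_def C_def)
  qed (simp add: gamma_density_def)
  have "(\<integral>\<^sup>+v. ennreal (v * gamma_density a\<^sub>1 \<alpha>\<^sub>1 v * gamma_density a\<^sub>2 \<alpha>\<^sub>2 (u * v)) \<partial>lborel)
      = (\<integral>\<^sup>+v. ennreal C * ennreal (indicator {0<..} v *
            (v powr (\<alpha>\<^sub>1 + \<alpha>\<^sub>2 + 1) * exp (- (a\<^sub>1 + a\<^sub>2 * u) * v))) \<partial>lborel)"
    unfolding integrand using C by (simp add: ennreal_mult')
  also have "\<dots> = ennreal C * ennreal (Gamma (\<alpha>\<^sub>1 + \<alpha>\<^sub>2 + 1 + 1)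
                    / (a\<^sub>1 + a\<^sub>2 * u) powr (\<alpha>\<^sub>1 + \<alpha>\<^sub>2 + 1 + 1))"
    by (subst nn_integral_cmult) (use nn_integral_powr_exp[OF b, of "\<alpha>\<^sub>1 + \<alpha>\<^sub>2 + 1"] \<alpha> in auto)
  also have "\<dots> = ennreal (C * (Gamma (\<alpha>\<^sub>1 + \<alpha>\<^sub>2 + 2) / (a\<^sub>1 + a\<^sub>2 * u) powr (\<alpha>\<^sub>1 + \<alpha>\<^sub>2 + 2)))"
    using C by (simp add: add.assoc ennreal_mult' del: times_divide_eq_right)
  also have "C * (Gamma (\<alpha>\<^sub>1 + \<alpha>\<^sub>2 + 2) / (a\<^sub>1 + a\<^sub>2 * u) powr (\<alpha>\<^sub>1 + \<alpha>\<^sub>2 + 2))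
      = gamma_ratio_density a\<^sub>1 \<alpha>\<^sub>1 a\<^sub>2 \<alpha>\<^sub>2 u"
    unfolding C_def gamma_ratio_density_def powr_minus divide_inverse by (simp only: mult_ac)
  finally show ?thesis .
qed

lemma set_integral_ratio_gamma_density:
  assumes a: "a\<^sub>1 > 0" "a\<^sub>2 > 0" and \<alpha>: "\<alpha>\<^sub>1 > -1" "\<alpha>\<^sub>2 > -1" and u: "u > 0"
  shows "(LINT v:{0<..}|lborel. v * gamma_density a\<^sub>1 \<alpha>\<^sub>1 v * gamma_density a\<^sub>2 \<alpha>\<^sub>2 (u * v))
           = gamma_ratio_density a\<^sub>1 \<alpha>\<^sub>1 a\<^sub>2 \<alpha>\<^sub>2 u"
proof -
  have "0 \<le> v * gamma_density a\<^sub>1 \<alpha>\<^sub>1 v * gamma_density a\<^sub>2 \<alpha>\<^sub>2 (u * v)" for v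
    by (cases "v > 0") (auto simp: gamma_density_nonneg \<alpha> gamma_density_eq_0)
  then have "has_bochner_integral lborel
      (\<lambda>v. v * gamma_density a\<^sub>1 \<alpha>\<^sub>1 v * gamma_density a\<^sub>2 \<alpha>\<^sub>2 (u * v)) (gamma_ratio_density a\<^sub>1 \<alpha>\<^sub>1 a\<^sub>2 \<alpha>\<^sub>2 u)"
    using nn_integral_ratio_gamma_density[OF assms] gamma_ratio_density_nonneg[OF \<alpha>]
    by (intro has_bochner_integral_nn_integral) auto
  moreover have "indicator {0<..} v *\<^sub>R (v * gamma_density a\<^sub>1 \<alpha>\<^sub>1 v * gamma_density a\<^sub>2 \<alpha>\<^sub>2 (u * v))
      = v * gamma_density a\<^sub>1 \<alpha>\<^sub>1 v * gamma_density a\<^sub>2 \<alpha>\<^sub>2 (u * v)" for v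
    by (simp add: gamma_density_def indicator_def)
  ultimately show ?thesis
    by (simp only: set_lebesgue_integral_def has_bochner_integral_integral_eq)
qed

text \<open>
  Extended nonnegative integrals turn the convolution formula into an identity on the whole line, to
  which the factorization of the double integral applies; integrability is then a consequence of the
  finite value.
\<close>

lemma prob_density_on_gamma_ratio_density:
  assumes a: "a\<^sub>1 > 0" "a\<^sub>2 > 0" and \<alpha>: "\<alpha>\<^sub>1 > -1" "\<alpha>\<^sub>2 > -1"
  shows "prob_density_on {0<..} (gamma_ratio_density a\<^sub>1 \<alpha>\<^sub>1 a\<^sub>2 \<alpha>\<^sub>2)"
proof -
  let ?f = "gamma_density a\<^sub>1 \<alpha>\<^sub>1" and ?g = "gamma_density a\<^sub>2 \<alpha>\<^sub>2"
  let ?r = "gamma_ratio_density a\<^sub>1 \<alpha>\<^sub>1 a\<^sub>2 \<alpha>\<^sub>2"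
  have convolution: "ennreal (indicator {0<..} u * ?r u)
      = (\<integral>\<^sup>+v. ennreal v * ennreal (?f v) * ennreal (?g (u * v)) \<partial>lborel)" for u
  proof -
    have split: "ennreal v * ennreal (?f v) * ennreal (?g (u * v))
        = ennreal (v * ?f v * ?g (u * v))" for v
      by (cases "v > 0") (auto simp: ennreal_mult' gamma_density_nonneg \<alpha> gamma_density_eq_0)
    show ?thesis
    proof (cases "u > 0")
      case True
      then show ?thesis
        using nn_integral_ratio_gamma_density[OF assms True] by (simp add: split)
    next
      case False
      then have vanish: "v * ?f v * ?g (u * v) = 0" for v
        by (auto simp: gamma_density_def indicator_def zero_less_mult_iff)
      then show ?thesis using False by (simp add: split vanish)
    qed
  qed
  have "(\<integral>\<^sup>+u. ennreal (indicator {0<..} u * ?r u) \<partial>lborel)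
      = (\<integral>\<^sup>+v. ennreal (?f v) \<partial>lborel) * (\<integral>\<^sup>+w. ennreal (?g w) \<partial>lborel)"
    unfolding convolution
    by (rule nn_integral_ratio_convolution) (auto simp: gamma_density_eq_0)
  also have "\<dots> = ennreal 1"
    using assms by (simp add: nn_integral_gamma_density)
  finally have "has_bochner_integral lborel (\<lambda>u. indicator {0<..} u * ?r u) 1"
    using gamma_ratio_density_nonneg[OF \<alpha>] by (intro has_bochner_integral_nn_integral) auto
  then show ?thesis
    using gamma_ratio_density_nonneg[OF \<alpha>]
    by (simp add: prob_density_on_def set_integrable_def set_lebesgue_integral_def
        has_bochner_integral_iff)
qed

section \<open>The hypergeometric form\<close>

text \<open>
  The negative real axis lies in the cut plane, where the continuation is given by the principal
  power.
\<close>

lemma hyp1F0_minus_of_real: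
  fixes b x :: real
  assumes x: "x \<ge> 0"
  shows "hyp1F0 (of_real b) (of_real (- x)) = of_real ((1 + x) powr (- b))"
proof -
  have "complex_of_real (- x) \<in> cut_plane"
    using x by (auto simp: cut_plane_iff complex_nonpos_Reals_iff)
  then have "hyp1F0 (of_real b) (of_real (- x)) = (1 - of_real (- x)) powr (- of_real b)"
    by (rule hyp1F0_eq[OF is_hyp1F0_powr])
  also have "\<dots> = complex_of_real (1 + x) powr complex_of_real (- b)"
    by simp
  also have "\<dots> = of_real ((1 + x) powr (- b))"
    using x by (intro powr_of_real) simp
  finally show ?thesis .
qed

text \<open>
  The left-hand side is homogeneous of degree 0 in \<open>(p, q)\<close>, hence a function of \<open>q / p\<close>. It is also
  symmetric under exchanging \<open>(p, s)\<close> with \<open>(q, t)\<close>, which gives the two cases of the hypergeometric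
  formula.
\<close>

lemma powr_sum_factor:
  fixes p q s t :: real
  assumes "p > 0" "q > 0"
  shows "p powr s * q powr t * (p + q) powr (- (s + t)) = (q / p) powr t * (1 + q / p) powr (- (s + t))"
proof -
  have "p + q = p * (1 + q / p)" using assms by (simp add: field_simps)
  then have "(p + q) powr (- (s + t)) = p powr (- (s + t)) * (1 + q / p) powr (- (s + t))"
    using assms by (metis powr_mult)
  also have "p powr (- (s + t)) = inverse (p powr s) * inverse (p powr t)"
    by (simp add: powr_diff powr_minus divide_inverse)
  finally have sum: "(p + q) powr (- (s + t)) =
      inverse (p powr s) * inverse (p powr t) * (1 + q / p) powr (- (s + t))" .
  have quotient: "(q / p) powr t = q powr t * inverse (p powr t)"
    using assms by (subst powr_divide) (auto simp: divide_inverse)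
  have cancel: "p powr s * inverse (p powr s) = 1"
    using assms by simp
  have "p powr s * q powr t * (p + q) powr (- (s + t)) =
      (p powr s * inverse (p powr s)) * (q powr t * inverse (p powr t)) * (1 + q / p) powr (- (s + t))"
    unfolding sum by (simp only: mult_ac)
  then show ?thesis
    unfolding cancel quotient by (simp only: mult_1)
qed

lemma gamma_ratio_density_hyp1F0:
  fixes a\<^sub>1 a\<^sub>2 \<alpha>\<^sub>1 \<alpha>\<^sub>2 u :: real
  assumes a: "a\<^sub>1 > 0" "a\<^sub>2 > 0" and u: "u > 0"
  defines "K \<equiv> Gamma (\<alpha>\<^sub>1 + \<alpha>\<^sub>2 + 2) / (Gamma (\<alpha>\<^sub>1 + 1) * Gamma (\<alpha>\<^sub>2 + 1)) * (1 / u)"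
  shows "of_real (gamma_ratio_density a\<^sub>1 \<alpha>\<^sub>1 a\<^sub>2 \<alpha>\<^sub>2 u)
           = of_real K * (of_real ((a\<^sub>2 * u / a\<^sub>1) powr (\<alpha>\<^sub>2 + 1)) *
               hyp1F0 (of_real (2 + \<alpha>\<^sub>1 + \<alpha>\<^sub>2)) (of_real (- (a\<^sub>2 * u / a\<^sub>1))))" (is ?small)
    and "of_real (gamma_ratio_density a\<^sub>1 \<alpha>\<^sub>1 a\<^sub>2 \<alpha>\<^sub>2 u)
           = of_real K * (of_real ((a\<^sub>1 / (a\<^sub>2 * u)) powr (\<alpha>\<^sub>1 + 1)) *
               hyp1F0 (of_real (2 + \<alpha>\<^sub>1 + \<alpha>\<^sub>2)) (of_real (- (a\<^sub>1 / (a\<^sub>2 * u)))))" (is ?large)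
proof -
  have q: "a\<^sub>2 * u > 0" using a u by simp
  have symmetric_form: "gamma_ratio_density a\<^sub>1 \<alpha>\<^sub>1 a\<^sub>2 \<alpha>\<^sub>2 u = K * (a\<^sub>1 powr (\<alpha>\<^sub>1 + 1) *
          (a\<^sub>2 * u) powr (\<alpha>\<^sub>2 + 1) * (a\<^sub>1 + a\<^sub>2 * u) powr (- (2 + \<alpha>\<^sub>1 + \<alpha>\<^sub>2)))"
  proof -
    have "(a\<^sub>2 * u) powr (\<alpha>\<^sub>2 + 1) = a\<^sub>2 powr (\<alpha>\<^sub>2 + 1) * u powr \<alpha>\<^sub>2 * u"
      using a u by (simp add: powr_mult powr_add)
    moreover have "- (\<alpha>\<^sub>1 + \<alpha>\<^sub>2 + 2) = - (2 + \<alpha>\<^sub>1 + \<alpha>\<^sub>2)" by simp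
    ultimately show ?thesis
      using u by (simp only: gamma_ratio_density_def K_def) simp
  qed
  have "gamma_ratio_density a\<^sub>1 \<alpha>\<^sub>1 a\<^sub>2 \<alpha>\<^sub>2 u
      = K * ((a\<^sub>2 * u / a\<^sub>1) powr (\<alpha>\<^sub>2 + 1) * (1 + a\<^sub>2 * u / a\<^sub>1) powr (- (2 + \<alpha>\<^sub>1 + \<alpha>\<^sub>2)))"
    using powr_sum_factor[OF a(1) q, of "\<alpha>\<^sub>1 + 1" "\<alpha>\<^sub>2 + 1"] unfolding symmetric_form
    by (simp add: algebra_simps)
  moreover have "hyp1F0 (of_real (2 + \<alpha>\<^sub>1 + \<alpha>\<^sub>2)) (of_real (- (a\<^sub>2 * u / a\<^sub>1)))
      = of_real ((1 + a\<^sub>2 * u / a\<^sub>1) powr (- (2 + \<alpha>\<^sub>1 + \<alpha>\<^sub>2)))"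
    using a q by (intro hyp1F0_minus_of_real) simp
  ultimately show ?small by (simp only: of_real_mult)
  have "gamma_ratio_density a\<^sub>1 \<alpha>\<^sub>1 a\<^sub>2 \<alpha>\<^sub>2 u
      = K * ((a\<^sub>1 / (a\<^sub>2 * u)) powr (\<alpha>\<^sub>1 + 1) * (1 + a\<^sub>1 / (a\<^sub>2 * u)) powr (- (2 + \<alpha>\<^sub>1 + \<alpha>\<^sub>2)))"
    using powr_sum_factor[OF q a(1), of "\<alpha>\<^sub>2 + 1" "\<alpha>\<^sub>1 + 1"] unfolding symmetric_form
    by (simp add: algebra_simps)
  moreover have "hyp1F0 (of_real (2 + \<alpha>\<^sub>1 + \<alpha>\<^sub>2)) (of_real (- (a\<^sub>1 / (a\<^sub>2 * u))))
      = of_real ((1 + a\<^sub>1 / (a\<^sub>2 * u)) powr (- (2 + \<alpha>\<^sub>1 + \<alpha>\<^sub>2)))"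
    using a q by (intro hyp1F0_minus_of_real) simp
  ultimately show ?large by (simp only: of_real_mult)
qed

section \<open>The density of the ratio of two Gamma variables\<close>

theorem theorem3p1:
  fixes a \<alpha> :: "nat \<Rightarrow> real" and f :: "nat \<Rightarrow> real \<Rightarrow> real" and g2 :: "real \<Rightarrow> real" and c :: real
  assumes a: "\<And>j. j \<in> {1, 2} \<Longrightarrow> a j > 0"
    and \<alpha>: "\<And>j. j \<in> {1, 2} \<Longrightarrow> \<alpha> j > -1"
    and f: "\<And>j x. j \<in> {1, 2} \<Longrightarrow> x > 0 \<Longrightarrow>
        f j x = a j powr (\<alpha> j + 1) / Gamma (\<alpha> j + 1) * x powr \<alpha> j * exp (- a j * x)"
    and c: "c = (\<Prod>j=1..2. a j powr (\<alpha> j + 1) / Gamma (\<alpha> j + 1))"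
    and g2: "\<And>u. u > 0 \<Longrightarrow> g2 u = (LINT v:{0<..}|lborel. v * f 1 v * f 2 (u * v))"
  shows "(\<forall>u>0. g2 u = c * Gamma (\<alpha> 1 + \<alpha> 2 + 2) * u powr \<alpha> 2
              * (a 1 + a 2 * u) powr (- (\<alpha> 1 + \<alpha> 2 + 2)))
       \<and> (\<forall>u>0. complex_of_real (g2 u) =
            of_real (Gamma (\<alpha> 1 + \<alpha> 2 + 2) / (Gamma (\<alpha> 1 + 1) * Gamma (\<alpha> 2 + 1)) * (1 / u)) *
            (if a 2 * u / a 1 < 1
             then of_real ((a 2 * u / a 1) powr (\<alpha> 2 + 1)) *
                  hyp1F0 (of_real (2 + \<alpha> 1 + \<alpha> 2)) (of_real (- (a 2 * u / a 1)))
             else of_real ((a 1 / (a 2 * u)) powr (\<alpha> 1 + 1)) *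
                  hyp1F0 (of_real (2 + \<alpha> 1 + \<alpha> 2)) (of_real (- (a 1 / (a 2 * u))))))
       \<and> prob_density_on {0<..} g2"
proof -
  have a': "a 1 > 0" "a 2 > 0" and \<alpha>': "\<alpha> 1 > -1" "\<alpha> 2 > -1"
    using a \<alpha> by auto
  let ?r = "gamma_ratio_density (a 1) (\<alpha> 1) (a 2) (\<alpha> 2)"
  have g2_eq: "g2 u = ?r u" if u: "u > 0" for u
  proof -
    have "g2 u = (LINT v:{0<..}|lborel.
        v * gamma_density (a 1) (\<alpha> 1) v * gamma_density (a 2) (\<alpha> 2) (u * v))"
      unfolding g2[OF u] set_lebesgue_integral_def
      by (intro Bochner_Integration.integral_cong)
         (use u in \<open>auto simp: indicator_def gamma_density_def f\<close>)
    then show ?thesis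
      using set_integral_ratio_gamma_density[OF a' \<alpha>' u] by simp
  qed
  have "c = a 1 powr (\<alpha> 1 + 1) / Gamma (\<alpha> 1 + 1) * (a 2 powr (\<alpha> 2 + 1) / Gamma (\<alpha> 2 + 1))"
    by (simp add: c numeral_2_eq_2)
  then have closed_form: "\<forall>u>0. g2 u = c * Gamma (\<alpha> 1 + \<alpha> 2 + 2) * u powr \<alpha> 2
              * (a 1 + a 2 * u) powr (- (\<alpha> 1 + \<alpha> 2 + 2))"
    by (simp add: g2_eq gamma_ratio_density_def)
  have "indicator {0<..} u *\<^sub>R g2 u = indicator {0<..} u *\<^sub>R ?r u" for u
    by (cases "u > 0") (auto simp: g2_eq)
  then have "prob_density_on {0<..} g2 \<longleftrightarrow> prob_density_on {0<..} ?r"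
    by (simp only: prob_density_on_def set_integrable_def set_lebesgue_integral_def)
       (simp add: g2_eq)
  then have density: "prob_density_on {0<..} g2"
    using prob_density_on_gamma_ratio_density[OF a' \<alpha>'] by simp
  note hypergeometric = gamma_ratio_density_hyp1F0[OF a', of _ "\<alpha> 1" "\<alpha> 2"]
  show ?thesis
  proof (intro conjI allI impI)
    fix u :: real assume u: "u > 0"
    show "complex_of_real (g2 u) =
            of_real (Gamma (\<alpha> 1 + \<alpha> 2 + 2) / (Gamma (\<alpha> 1 + 1) * Gamma (\<alpha> 2 + 1)) * (1 / u)) *
            (if a 2 * u / a 1 < 1
             then of_real ((a 2 * u / a 1) powr (\<alpha> 2 + 1)) *
                  hyp1F0 (of_real (2 + \<alpha> 1 + \<alpha> 2)) (of_real (- (a 2 * u / a 1)))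
             else of_real ((a 1 / (a 2 * u)) powr (\<alpha> 1 + 1)) *
                  hyp1F0 (of_real (2 + \<alpha> 1 + \<alpha> 2)) (of_real (- (a 1 / (a 2 * u)))))"
      using hypergeometric[OF u] unfolding g2_eq[OF u] by presburger
  qed (use closed_form density in blast)+
qed

end
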